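(* Let $n\ge 1$ and $0\le k\le n$ be fixed integers. Consider a tiled polyhedral program (fixed-size tiling) with a single size parameter $S$, given by a tiled polyhedral reduced dependence graph with a finite, $S$-independent set of nodes, whose total number of tile instances is $\Theta(S^n)$. Let $\{\theta_X=(\pi_X,\tau_X)\}_X$ be a hybrid static-dynamic (HSD) schedule for the program into a common $n$-dimensional space-time with $k$ processor dimensions and $n-k$ time dimensions. Then the memory overhead of the HSD schedule is $\Theta(S^k)$ as $S\to\infty$; that is, it grows as a polynomial in $S$ whose degree is the number $k$ of processor dimensions of the schedule.
   Context: Tiled program. A tiled polyhedral reduced dependence graph (PRDG) has finitely many nodes $X$ (each a "tile signature"), the set of nodes being independent of $S$. Each node $X$ has a domain $\mathcal D_X=\mathcal D_X(S)$, the set of tile instances of signature $X$: it is the set of integer points of a finite union of bounded polyhedra defined by finitely many affine inequalities in the tile indices and in the single integer size parameter $S$ (with coefficients that do not depend on $S$). The total number of tile instances is $\sum_X|\mathcal D_X(S)|=\Theta(S^n)$, where $n$ is the maximum number of dimensions of the computation and is also the dimension of the schedule below. The dependence edges of the PRDG play no role in the memory count. HSD schedule. An HSD schedule for a node $X$ is an affine function $\theta_X$ (linear part independent of $S$, constant part affine in $S$) mapping each point $z\in\mathcal D_X$ to an integer $n$-vector, such that $\theta_X$ is a bijection onto its image. The first $k$ coordinates, $\pi_X(z)\in\mathbb Z^k$, are the (virtual) processor coordinates of $z$, and the last $n-k$ coordinates, $\tau_X(z)\in\mathbb Z^{n-k}$, are its local time coordinates. An HSD schedule for a program is a choice of an HSD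 schedule $\theta_X$ for every node $X$, all with the same $n$ and $k$. Memory overhead. The run-time system maintains, for every node $X$, a shared array $\mathrm{State}_X$ with one entry for each virtual processor $p\in\pi_X(\mathcal D_X)$. The entry $\mathrm{State}_X[p]$ holds an $(n-k)$-tuple of integers (the most recent local time stamp completed by $p$ for signature $X$), and each such entry is counted as $\Theta(1)$ space. The memory overhead of the HSD schedule is the total space of these arrays; up to constant factors independent of $S$, it is $\sum_X|\pi_X(\mathcal D_X(S))|$, equivalently $\left|\bigcup_X\pi_X(\mathcal D_X(S))\right|$, the number of virtual processors. *)

theory Defs
  imports "Jordan_Normal_Form.Matrix" "HOL-Library.Landau_Symbols"
begin

text \<open>
  Dimensions are natural numbers (they vary from node to node, and \<open>k = 0\<close> is allowed), so
  vectors and matrices carry explicit dimensions. The size parameter \<open>S\<close> ranges over the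
  positive integers, represented as \<open>nat\<close> with \<open>S > 0\<close>.
\<close>

type_synonym ipoint = "int vec"
type_synonym rpoint = "real vec"

abbreviation rpoint_of :: "ipoint \<Rightarrow> rpoint" where
  "rpoint_of \<equiv> map_vec real_of_int"

text \<open>
  \<open>Param_Affine A b c\<close> is the family of affine maps \<open>z \<mapsto> A z + S b + c\<close>: the linear part
  does not depend on \<open>S\<close> and the constant part is affine in \<open>S\<close>.
\<close>

datatype param_affine =
  Param_Affine (lin_part: "real mat") (size_part: rpoint) (const_part: rpoint)

definition is_param_affine :: "nat \<Rightarrow> nat \<Rightarrow> param_affine \<Rightarrow> bool" where
  "is_param_affine m d f \<longleftrightarrow>
     lin_part f \<in> carrier_mat m d \<and> size_part f \<in> carrier_vec m \<and> const_part f \<in> carrier_vec m"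

definition affine_at :: "param_affine \<Rightarrow> nat \<Rightarrow> rpoint \<Rightarrow> rpoint" where
  "affine_at f S z = lin_part f *\<^sub>v z + real S \<cdot>\<^sub>v size_part f + const_part f"

text \<open>The inequality below is componentwise, one inequality per row of the linear part.\<close>

definition polyhedron_at :: "nat \<Rightarrow> param_affine \<Rightarrow> nat \<Rightarrow> rpoint set" where
  "polyhedron_at d f S =
     {z \<in> carrier_vec d. 0\<^sub>v (dim_row (lin_part f)) \<le> affine_at f S z}"

definition bounded_points :: "nat \<Rightarrow> rpoint set \<Rightarrow> bool" where
  "bounded_points d P \<longleftrightarrow> (\<exists>B. \<forall>z\<in>P. \<forall>i<d. \<bar>z $ i\<bar> \<le> B)"

definition is_tile_domain :: "nat \<Rightarrow> (nat \<Rightarrow> ipoint set) \<Rightarrow> bool" where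
  "is_tile_domain d D \<longleftrightarrow>
     (\<exists>F. finite F \<and>
        (\<forall>f\<in>F. \<exists>m. is_param_affine m d f) \<and>
        (\<forall>S>0. (\<forall>f\<in>F. bounded_points d (polyhedron_at d f S)) \<and>
               D S = {z \<in> carrier_vec d. rpoint_of z \<in> (\<Union>f\<in>F. polyhedron_at d f S)}))"

text \<open>
  A tiled program is given by its node set \<open>N\<close>, the index dimension \<open>d X\<close> and the domain
  \<open>D X S\<close> of every node \<open>X\<close>. Dependence edges are irrelevant for the memory count and are
  not represented.
\<close>

definition tiled_program :: "'x set \<Rightarrow> ('x \<Rightarrow> nat) \<Rightarrow> ('x \<Rightarrow> nat \<Rightarrow> ipoint set) \<Rightarrow> bool" where
  "tiled_program N d D \<longleftrightarrow> finite N \<and> (\<forall>X\<in>N. is_tile_domain (d X) (D X))"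

definition num_tile_instances :: "'x set \<Rightarrow> ('x \<Rightarrow> nat \<Rightarrow> ipoint set) \<Rightarrow> nat \<Rightarrow> nat" where
  "num_tile_instances N D S = (\<Sum>X\<in>N. card (D X S))"

text \<open>
  Coefficients of a schedule may be arbitrary reals; only the values on the domain have to be
  integer vectors.
\<close>

definition is_node_schedule ::
    "nat \<Rightarrow> nat \<Rightarrow> (nat \<Rightarrow> ipoint set) \<Rightarrow> (nat \<Rightarrow> ipoint \<Rightarrow> ipoint) \<Rightarrow> bool" where
  "is_node_schedule n d D \<theta> \<longleftrightarrow>
     (\<exists>f. is_param_affine n d f \<and>
        (\<forall>S>0. \<forall>z\<in>D S. rpoint_of (\<theta> S z) = affine_at f S (rpoint_of z))) \<and>
     (\<forall>S>0. bij_betw (\<theta> S) (D S) (\<theta> S ` D S))"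

definition hsd_schedule ::
    "nat \<Rightarrow> 'x set \<Rightarrow> ('x \<Rightarrow> nat) \<Rightarrow> ('x \<Rightarrow> nat \<Rightarrow> ipoint set) \<Rightarrow>
     ('x \<Rightarrow> nat \<Rightarrow> ipoint \<Rightarrow> ipoint) \<Rightarrow> bool" where
  "hsd_schedule n N d D \<theta> \<longleftrightarrow> (\<forall>X\<in>N. is_node_schedule n (d X) (D X) (\<theta> X))"

text \<open>
  With \<open>k\<close> processor dimensions, \<open>\<pi>\<^sub>X(z)\<close> consists of the first \<open>k\<close> coordinates of
  \<open>\<theta>\<^sub>X(z)\<close>; the remaining \<open>n - k\<close> coordinates, \<open>vec_last (\<theta> X S z) (n - k)\<close>, are the
  local time \<open>\<tau>\<^sub>X(z)\<close>, which does not enter the memory count.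
\<close>

definition proc_coords ::
    "nat \<Rightarrow> ('x \<Rightarrow> nat \<Rightarrow> ipoint \<Rightarrow> ipoint) \<Rightarrow> 'x \<Rightarrow> nat \<Rightarrow> ipoint \<Rightarrow> ipoint" where
  "proc_coords k \<theta> X S z = vec_first (\<theta> X S z) k"

definition virtual_procs ::
    "nat \<Rightarrow> ('x \<Rightarrow> nat \<Rightarrow> ipoint set) \<Rightarrow> ('x \<Rightarrow> nat \<Rightarrow> ipoint \<Rightarrow> ipoint) \<Rightarrow>
     'x \<Rightarrow> nat \<Rightarrow> ipoint set" where
  "virtual_procs k D \<theta> X S = proc_coords k \<theta> X S ` D X S"

text \<open>
  \<open>w X S p\<close> is the space taken by the array entry \<open>State\<^sub>X[p]\<close>. Counting an entry as
  \<open>\<Theta>(1)\<close> means that \<open>w\<close> lies between two positive constants independent of \<open>X\<close>, \<open>S\<close> and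
  \<open>p\<close>.
\<close>

definition constant_space_entries ::
    "nat \<Rightarrow> 'x set \<Rightarrow> ('x \<Rightarrow> nat \<Rightarrow> ipoint set) \<Rightarrow> ('x \<Rightarrow> nat \<Rightarrow> ipoint \<Rightarrow> ipoint) \<Rightarrow>
     ('x \<Rightarrow> nat \<Rightarrow> ipoint \<Rightarrow> real) \<Rightarrow> bool" where
  "constant_space_entries k N D \<theta> w \<longleftrightarrow>
     (\<exists>c\<^sub>1>0. \<exists>c\<^sub>2. \<forall>X\<in>N. \<forall>S>0. \<forall>p\<in>virtual_procs k D \<theta> X S. c\<^sub>1 \<le> w X S p \<and> w X S p \<le> c\<^sub>2)"

definition memory_overhead ::
    "nat \<Rightarrow> 'x set \<Rightarrow> ('x \<Rightarrow> nat \<Rightarrow> ipoint set) \<Rightarrow> ('x \<Rightarrow> nat \<Rightarrow> ipoint \<Rightarrow> ipoint) \<Rightarrow>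
     ('x \<Rightarrow> nat \<Rightarrow> ipoint \<Rightarrow> real) \<Rightarrow> nat \<Rightarrow> real" where
  "memory_overhead k N D \<theta> w S = (\<Sum>X\<in>N. \<Sum>p\<in>virtual_procs k D \<theta> X S. w X S p)"

lemma memory_overhead_unit_entries:
  "memory_overhead k N D \<theta> (\<lambda>_ _ _. 1) S = (\<Sum>X\<in>N. real (card (virtual_procs k D \<theta> X S)))"
  by (simp add: memory_overhead_def)

end

theory Submission
  imports "HOL-Analysis.Function_Topology" Defs
begin

text \<open>
  A non-empty bounded polyhedron has trivial recession cone, and the recession cone does not
  depend on \<open>S\<close>. By compactness of the unit sphere of the maximum norm, the violation of the
  homogeneous inequalities then grows at least linearly in the norm, so all tile indices, and
  with them all coordinates of the schedule, are \<open>O(S)\<close>. Hence there are \<open>O(S\<^sup>k)\<close> virtual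
  processors. Conversely, a schedule is injective, so each virtual processor of a node executes
  at most \<open>O(S\<^sup>n\<^sup>-\<^sup>k)\<close> of its tiles, and \<open>\<Theta>(S\<^sup>n)\<close> tiles need at least a multiple of \<open>S\<^sup>k\<close>
  processors.
\<close>

section \<open>Coercivity of homogeneous inequality systems\<close>

lemma linear_violation_coercive:
  fixes M :: "nat \<Rightarrow> nat \<Rightarrow> real"
  assumes triv: "\<And>z. \<forall>i<m. 0 \<le> (\<Sum>j<d. M i j * z j) \<Longrightarrow> \<forall>j<d. z j = 0"
  obtains \<delta> where "\<delta> > 0"
    "\<And>z j. j < d \<Longrightarrow> \<delta> * \<bar>z j\<bar> \<le> (\<Sum>i<m. max 0 (- (\<Sum>j<d. M i j * z j)))"
proof -
  define g where "g z = (\<Sum>i<m. max 0 (- (\<Sum>j<d. M i j * z j)))" for z :: "nat \<Rightarrow> real"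
  \<comment> \<open>Vectors are functions on \<open>nat\<close>, so that \<open>d\<close> may vary.
    Pinning the coordinates from \<open>d\<close> on to 0 makes every factor of the product compact,
    and Tychonoff's theorem then gives compactness of the cube.\<close>
  define K :: "(nat \<Rightarrow> real) set" where "K = PiE UNIV (\<lambda>j. if j < d then {-1..1} else {0})"
  \<comment> \<open>The unit sphere of the maximum norm, written as a finite union of closed pieces
    of \<open>K\<close>. On it \<open>g\<close> is continuous and positive, so its minimum can serve
    as \<open>\<delta>\<close>.\<close>
  define B :: "(nat \<Rightarrow> real) set" where "B = (\<Union>j<d. K \<inter> {z. \<bar>z j\<bar> = 1})"
  have "compactin (product_topology (\<lambda>_. euclidean) UNIV) K"
    unfolding K_def by (subst compactin_PiE) auto
  then have "compact K"
    by (simp add: euclidean_product_topology)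
  moreover have "closed {z :: nat \<Rightarrow> real. \<bar>z j\<bar> = 1}" for j
    by (intro closed_Collect_eq continuous_intros) simp
  ultimately have "compact B"
    unfolding B_def by (intro compact_UN compact_Int_closed) auto
  have gcont: "continuous_on B g"
    unfolding g_def by (intro continuous_intros) (rule continuous_on_subset[OF continuous_on_product_coordinates subset_UNIV])
  have gnonneg: "0 \<le> g z" for z
    unfolding g_def by (intro sum_nonneg) auto
  have gpos: "0 < g z" if "z \<in> B" for z
  proof (rule ccontr)
    assume "\<not> 0 < g z"
    then have "g z = 0" using gnonneg[of z] by simp
    then have "\<forall>i<m. max 0 (- (\<Sum>j<d. M i j * z j)) = 0"
      unfolding g_def by (subst (asm) sum_nonneg_eq_0_iff) auto
    then have "\<forall>j<d. z j = 0"
      by (intro triv) (auto simp: max_def split: if_splits)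
    with that show False by (auto simp: B_def)
  qed
  obtain \<delta> where \<delta>: "\<delta> > 0" "\<And>z. z \<in> B \<Longrightarrow> \<delta> \<le> g z"
  proof (cases "B = {}")
    \<comment> \<open>This happens only for \<open>d = 0\<close>, where the claim is vacuous and any
      positive constant will do.\<close>
    case True
    then show ?thesis using that[of 1] by auto
  next
    case False
    then obtain x where "x \<in> B" "\<forall>y\<in>B. g x \<le> g y"
      using continuous_attains_inf[OF \<open>compact B\<close> _ gcont] by blast
    then show ?thesis using that[of "g x"] gpos by auto
  qed
  have "\<delta> * \<bar>z j\<bar> \<le> g z" if "j < d" for z j
  proof -
    have ne: "{..<d} \<noteq> {}" using that by auto
    obtain l where l: "l < d" "\<And>i. i < d \<Longrightarrow> \<bar>z i\<bar> \<le> \<bar>z l\<bar>"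
    proof -
      have "Max ((\<lambda>i. \<bar>z i\<bar>) ` {..<d}) \<in> (\<lambda>i. \<bar>z i\<bar>) ` {..<d}"
        using ne by (intro Max_in) auto
      then obtain l where "l < d" "\<bar>z l\<bar> = Max ((\<lambda>i. \<bar>z i\<bar>) ` {..<d})" by auto
      then show ?thesis by (intro that[of l]) auto
    qed
    show ?thesis
    proof (cases "z l = 0")
      case True
      then have "z j = 0" using l(2)[OF that] by simp
      then show ?thesis using gnonneg by simp
    next
      case False
      define t where "t = \<bar>z l\<bar>"
      have t: "t > 0" using False by (simp add: t_def)
      \<comment> \<open>Rescaling by the maximum norm \<open>t\<close> puts \<open>z\<close> on the
        sphere. Cutting off the coordinates from \<open>d\<close> on is harmless, as
        \<open>g\<close> reads only those below \<open>d\<close>; positive homogeneity of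
        \<open>g\<close> carries the bound back to \<open>z\<close>.\<close>
      define y where "y i = (if i < d then z i / t else 0)" for i
      have "y \<in> K"
        using l(2) t by (auto simp: K_def y_def t_def[symmetric] abs_le_iff minus_le_iff field_simps)
      moreover have "\<bar>y l\<bar> = 1" using l(1) t by (simp add: y_def t_def)
      ultimately have "y \<in> B" using l(1) by (auto simp: B_def)
      then have "\<delta> \<le> g y" by (rule \<delta>)
      moreover have "g z = t * g y"
      proof -
        have "max 0 (- (\<Sum>j<d. M i j * z j)) = t * max 0 (- (\<Sum>j<d. M i j * y j))" for i
        proof -
          have "(\<Sum>j<d. M i j * z j) = t * (\<Sum>j<d. M i j * y j)"
            using t by (simp add: sum_distrib_left y_def)
          then show ?thesis using t by (simp add: max_def mult_less_0_iff zero_le_mult_iff mult_le_0_iff)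
        qed
        then show ?thesis by (simp add: g_def sum_distrib_left)
      qed
      moreover have "\<delta> * \<bar>z j\<bar> \<le> \<delta> * t"
        using \<delta>(1) l(2)[OF that] by (simp add: t_def)
      moreover have "\<delta> * t \<le> g y * t"
        using t \<open>\<delta> \<le> g y\<close> by simp
      ultimately show ?thesis by (simp add: mult.commute)
    qed
  qed
  with \<delta>(1) show ?thesis using that[of \<delta>] by (simp add: g_def)
qed

section \<open>Linear growth of parametric polyhedra and tile domains\<close>

lemma affine_at_index:
  assumes "is_param_affine m d f" "z \<in> carrier_vec d" "i < m"
  shows "affine_at f S z $ i =
    (\<Sum>j<d. lin_part f $$ (i, j) * z $ j) + real S * size_part f $ i + const_part f $ i"
  using assms unfolding is_param_affine_def affine_at_def
  by (auto simp: scalar_prod_def lessThan_atLeast0 intro!: sum.cong)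

lemma mem_polyhedron_at:
  assumes f: "is_param_affine m d f"
  shows "z \<in> polyhedron_at d f S \<longleftrightarrow> z \<in> carrier_vec d \<and> (\<forall>i<m.
    0 \<le> (\<Sum>j<d. lin_part f $$ (i, j) * z $ j) + real S * size_part f $ i + const_part f $ i)"
proof -
  have "dim_row (lin_part f) = m" and "dim_vec (affine_at f S z) = m"
    using f by (auto simp: is_param_affine_def affine_at_def)
  then show ?thesis
    using affine_at_index[OF f] by (auto simp: polyhedron_at_def less_eq_vec_def)
qed

text \<open>Moving from \<open>x\<close> along a recession direction \<open>v\<close> preserves
  every inequality, so a nonzero coordinate of \<open>v\<close> would make the polyhedron
  unbounded.\<close>

lemma bounded_polyhedron_recession_trivial:
  assumes f: "is_param_affine m d f"
    and bdd: "bounded_points d (polyhedron_at d f S)"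
    and x: "x \<in> polyhedron_at d f S"
    and v: "\<forall>i<m. 0 \<le> (\<Sum>j<d. lin_part f $$ (i, j) * v j)"
  shows "\<forall>j<d. v j = 0"
proof (intro allI impI)
  fix j assume j: "j < d"
  obtain B where B: "\<And>z i. z \<in> polyhedron_at d f S \<Longrightarrow> i < d \<Longrightarrow> \<bar>z $ i\<bar> \<le> B"
    using bdd by (auto simp: bounded_points_def)
  have ray: "\<bar>x $ j + t * v j\<bar> \<le> B" if "t \<ge> 0" for t
  proof -
    have "vec d (\<lambda>j. x $ j + t * v j) \<in> polyhedron_at d f S"
    proof (subst mem_polyhedron_at[OF f], safe)
      fix i assume i: "i < m"
      have "0 \<le> t * (\<Sum>j<d. lin_part f $$ (i, j) * v j)" using v i that by simp
      moreover have "0 \<le> (\<Sum>j<d. lin_part f $$ (i, j) * x $ j)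
          + real S * size_part f $ i + const_part f $ i"
        using x i by (simp add: mem_polyhedron_at[OF f])
      moreover have "(\<Sum>j<d. lin_part f $$ (i, j) * vec d (\<lambda>j. x $ j + t * v j) $ j)
          = (\<Sum>j<d. lin_part f $$ (i, j) * x $ j) + t * (\<Sum>j<d. lin_part f $$ (i, j) * v j)"
        by (simp add: sum_distrib_left sum.distrib[symmetric] algebra_simps)
      ultimately show "0 \<le> (\<Sum>j<d. lin_part f $$ (i, j) * vec d (\<lambda>j. x $ j + t * v j) $ j)
          + real S * size_part f $ i + const_part f $ i" by linarith
    qed simp
    from B[OF this j] show ?thesis using j by simp
  qed
  show "v j = 0"
  proof (rule ccontr)
    assume nz: "v j \<noteq> 0"
    \<comment> \<open>Far enough along the ray: coordinate \<open>j\<close> moves by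
      \<open>2 * B + 1\<close>, which from a start in \<open>[-B, B]\<close> ends outside that
      interval, whatever the sign of \<open>v j\<close>.\<close>
    define t where "t = (2 * B + 1) / \<bar>v j\<bar>"
    have "\<bar>x $ j\<bar> \<le> B" using ray[of 0] by simp
    then have "t \<ge> 0" by (simp add: t_def)
    have "\<bar>t * v j\<bar> = 2 * B + 1"
      using nz \<open>\<bar>x $ j\<bar> \<le> B\<close> by (simp add: t_def abs_mult)
    with ray[OF \<open>t \<ge> 0\<close>] \<open>\<bar>x $ j\<bar> \<le> B\<close> show False by linarith
  qed
qed

text \<open>A point of the polyhedron violates the homogeneous inequalities by at most the size of
  the constant part, which is affine in \<open>S\<close>. Coercivity turns this into a bound on the
  point, with one constant for all \<open>S\<close> because the linear part is fixed.\<close>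

lemma polyhedron_at_linear_bound:
  assumes f: "is_param_affine m d f"
    and bdd: "\<And>S. S > 0 \<Longrightarrow> bounded_points d (polyhedron_at d f S)"
  shows "\<exists>C\<ge>0. \<forall>S>0. \<forall>z\<in>polyhedron_at d f S. \<forall>j<d. \<bar>z $ j\<bar> \<le> C * real S"
proof (cases "\<exists>S>0. polyhedron_at d f S \<noteq> {}")
  case False
  then show ?thesis by (metis emptyE order_refl)
next
  case True
  then obtain S0 x where "S0 > 0" "x \<in> polyhedron_at d f S0" by auto
  \<comment> \<open>One nonempty instance \<open>S0\<close> suffices: the homogeneous inequalities
    do not mention \<open>S\<close>.\<close>
  note triv = bounded_polyhedron_recession_trivial[OF f bdd[OF this(1)] this(2)]
  obtain \<delta> where \<delta>: "\<delta> > 0" "\<And>z j. j < d \<Longrightarrow>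
      \<delta> * \<bar>z j\<bar> \<le> (\<Sum>i<m. max 0 (- (\<Sum>j<d. lin_part f $$ (i, j) * z j)))"
    using linear_violation_coercive[where M = "\<lambda>i j. lin_part f $$ (i, j)", OF triv] by blast
  define Q where "Q = (\<Sum>i<m. \<bar>size_part f $ i\<bar> + \<bar>const_part f $ i\<bar>)"
  have "Q \<ge> 0" unfolding Q_def by (intro sum_nonneg) auto
  have "\<bar>z $ j\<bar> \<le> Q / \<delta> * real S"
    if S: "S > 0" and z: "z \<in> polyhedron_at d f S" and j: "j < d" for S z j
  proof -
    have "\<delta> * \<bar>z $ j\<bar> \<le> (\<Sum>i<m. max 0 (- (\<Sum>j<d. lin_part f $$ (i, j) * z $ j)))"
      using \<delta>(2)[OF j] .
    also have "\<dots> \<le> (\<Sum>i<m. (\<bar>size_part f $ i\<bar> + \<bar>const_part f $ i\<bar>) * real S)"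
    proof (rule sum_mono)
      fix i assume "i \<in> {..<m}"
      then have "- (\<Sum>j<d. lin_part f $$ (i, j) * z $ j)
          \<le> real S * size_part f $ i + const_part f $ i"
        using z by (fastforce simp: mem_polyhedron_at[OF f])
      moreover have "real S * size_part f $ i \<le> \<bar>size_part f $ i\<bar> * real S"
        by (simp add: mult.commute mult_left_mono)
      \<comment> \<open>Since \<open>S\<close> is at least 1, the constant term is absorbed into the
        linear one.\<close>
      moreover have "\<bar>const_part f $ i\<bar> * 1 \<le> \<bar>const_part f $ i\<bar> * real S"
        using S by (intro mult_left_mono) auto
      moreover have "0 \<le> (\<bar>size_part f $ i\<bar> + \<bar>const_part f $ i\<bar>) * real S" by simp
      ultimately show "max 0 (- (\<Sum>j<d. lin_part f $$ (i, j) * z $ j))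
          \<le> (\<bar>size_part f $ i\<bar> + \<bar>const_part f $ i\<bar>) * real S"
        by (simp add: distrib_right)
    qed
    also have "\<dots> = Q * real S" by (simp add: Q_def sum_distrib_right)
    finally show ?thesis using \<delta>(1) by (simp add: field_simps)
  qed
  then show ?thesis
    using \<delta>(1) \<open>Q \<ge> 0\<close> by (intro exI[of _ "Q / \<delta>"]) auto
qed

text \<open>The sum of the individual nonnegative bounds dominates each of them; unlike a maximum,
  it also covers empty \<open>A\<close>. This merges the constants of the finitely many polyhedra of
  a domain and of the finitely many nodes.\<close>

lemma finite_common_bound:
  fixes P :: "'a \<Rightarrow> real \<Rightarrow> bool"
  assumes "finite A" "\<And>a. a \<in> A \<Longrightarrow> \<exists>C\<ge>0. P a C"
    and mono: "\<And>a C C'. a \<in> A \<Longrightarrow> P a C \<Longrightarrow> C \<le> C' \<Longrightarrow> P a C'"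
  shows "\<exists>C\<ge>0. \<forall>a\<in>A. P a C"
proof -
  obtain c where c: "\<And>a. a \<in> A \<Longrightarrow> 0 \<le> c a \<and> P a (c a)"
    using assms(2) by metis
  have "c a \<le> sum c A" if "a \<in> A" for a
    using assms(1) c that by (intro member_le_sum) auto
  then show ?thesis
    using c mono by (intro exI[of _ "sum c A"] conjI ballI) (auto intro: sum_nonneg, blast)
qed

lemma tile_domain_linear_bound:
  assumes "is_tile_domain d D"
  shows "\<exists>C\<ge>0. \<forall>S>0. \<forall>z\<in>D S. z \<in> carrier_vec d \<and> (\<forall>j<d. \<bar>real_of_int (z $ j)\<bar> \<le> C * real S)"
proof -
  obtain F where "finite F" and "(\<forall>f\<in>F. \<exists>m. is_param_affine m d f) \<and>
      (\<forall>S>0. (\<forall>f\<in>F. bounded_points d (polyhedron_at d f S)) \<and>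
        D S = {z \<in> carrier_vec d. rpoint_of z \<in> (\<Union>f\<in>F. polyhedron_at d f S)})"
    using assms unfolding is_tile_domain_def by (elim exE conjE) (rule that, assumption, intro conjI, assumption+)
  then have F: "finite F" "\<And>f. f \<in> F \<Longrightarrow> \<exists>m. is_param_affine m d f"
    "\<And>S f. S > 0 \<Longrightarrow> f \<in> F \<Longrightarrow> bounded_points d (polyhedron_at d f S)"
    "\<And>S. S > 0 \<Longrightarrow> D S = {z \<in> carrier_vec d. rpoint_of z \<in> (\<Union>f\<in>F. polyhedron_at d f S)}"
    by auto
  have "\<exists>C\<ge>0. \<forall>f\<in>F. \<forall>S>0. \<forall>z\<in>polyhedron_at d f S. \<forall>j<d. \<bar>z $ j\<bar> \<le> C * real S"
  proof (rule finite_common_bound[OF F(1)])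
    fix f assume "f \<in> F"
    then show "\<exists>C\<ge>0. \<forall>S>0. \<forall>z\<in>polyhedron_at d f S. \<forall>j<d. \<bar>z $ j\<bar> \<le> C * real S"
      using F(2,3) polyhedron_at_linear_bound by metis
  next
    fix f and C C' :: real
    assume C: "\<forall>S>0. \<forall>z\<in>polyhedron_at d f S. \<forall>j<d. \<bar>z $ j\<bar> \<le> C * real S" and "C \<le> C'"
    then have "C * real S \<le> C' * real S" for S by (simp add: mult_right_mono)
    with C show "\<forall>S>0. \<forall>z\<in>polyhedron_at d f S. \<forall>j<d. \<bar>z $ j\<bar> \<le> C' * real S"
      by (meson order_trans)
  qed
  then obtain C where C: "C \<ge> 0"
    "\<forall>f\<in>F. \<forall>S>0. \<forall>z\<in>polyhedron_at d f S. \<forall>j<d. \<bar>z $ j\<bar> \<le> C * real S" by auto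
  show ?thesis
  proof (intro exI[of _ C] conjI allI impI ballI C(1))
    fix S z assume S: "S > 0" and z: "z \<in> D S"
    then show zc: "z \<in> carrier_vec d" by (simp add: F(4))
    fix j assume j: "j < d"
    obtain f where "f \<in> F" "rpoint_of z \<in> polyhedron_at d f S"
      using z F(4)[OF S] by auto
    with C(2) S j have "\<bar>rpoint_of z $ j\<bar> \<le> C * real S" by blast
    then show "\<bar>real_of_int (z $ j)\<bar> \<le> C * real S" using zc j by simp
  qed
qed

section \<open>Counting integer points in boxes\<close>

definition int_box :: "nat \<Rightarrow> nat \<Rightarrow> ipoint set" where
  "int_box k b = {v \<in> carrier_vec k. \<forall>i<k. \<bar>v $ i\<bar> \<le> int b}"

text \<open>Tabulating coordinates presents the box as part of the image of a product of
  \<open>k\<close> finite intervals. For \<open>k = 0\<close> the box holds just the empty vector,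
  in agreement with the bound 1.\<close>

lemma finite_int_box: "finite (int_box k b)"
  and card_int_box_le: "card (int_box k b) \<le> (2 * b + 1) ^ k"
proof -
  let ?P = "PiE {..<k} (\<lambda>_. {- int b..int b})"
  have sub: "int_box k b \<subseteq> vec k ` ?P"
  proof
    fix v assume v: "v \<in> int_box k b"
    then have "restrict (($) v) {..<k} \<in> ?P"
      by (auto simp: int_box_def abs_le_iff minus_le_iff)
    moreover have "v = vec k (restrict (($) v) {..<k})"
      using v by (auto simp: int_box_def)
    ultimately show "v \<in> vec k ` ?P" by blast
  qed
  have fin: "finite ?P" by (intro finite_PiE) auto
  then show "finite (int_box k b)" using sub finite_surj by blast
  have "card (int_box k b) \<le> card ?P" using surj_card_le[OF fin sub] .
  also have "card ?P = (2 * b + 1) ^ k"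
    by (simp add: card_PiE nat_add_distrib nat_mult_distrib algebra_simps)
  finally show "card (int_box k b) \<le> (2 * b + 1) ^ k" .
qed

section \<open>Linear growth of schedules\<close>

lemma node_schedule_linear_bound:
  assumes D: "is_tile_domain d D" and sched: "is_node_schedule n d D \<theta>"
  shows "\<exists>C\<ge>0. \<forall>S>0. \<forall>z\<in>D S.
    \<theta> S z \<in> carrier_vec n \<and> (\<forall>i<n. \<bar>real_of_int (\<theta> S z $ i)\<bar> \<le> C * real S)"
proof -
  obtain B where B: "B \<ge> 0" "\<And>S z. S > 0 \<Longrightarrow> z \<in> D S \<Longrightarrow> z \<in> carrier_vec d"
    "\<And>S z j. S > 0 \<Longrightarrow> z \<in> D S \<Longrightarrow> j < d \<Longrightarrow> \<bar>real_of_int (z $ j)\<bar> \<le> B * real S"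
    using tile_domain_linear_bound[OF D] by metis
  obtain f where f: "is_param_affine n d f"
    "\<And>S z. S > 0 \<Longrightarrow> z \<in> D S \<Longrightarrow> rpoint_of (\<theta> S z) = affine_at f S (rpoint_of z)"
    using sched unfolding is_node_schedule_def by metis
  \<comment> \<open>\<open>c i\<close> estimates row \<open>i\<close> of the schedule term by term,
    using \<open>S >= 1\<close> for the constant part. The sum of all \<open>c i\<close> then serves
    every coordinate at once.\<close>
  define c where "c i = (\<Sum>j<d. \<bar>lin_part f $$ (i, j)\<bar> * B) + \<bar>size_part f $ i\<bar> + \<bar>const_part f $ i\<bar>" for i
  have c0: "c i \<ge> 0" for i
    unfolding c_def using B(1) by (intro add_nonneg_nonneg sum_nonneg) auto
  have bound: "\<theta> S z \<in> carrier_vec n" "i < n \<Longrightarrow> \<bar>real_of_int (\<theta> S z $ i)\<bar> \<le> sum c {..<n} * real S"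
    if S: "S > 0" and z: "z \<in> D S" for S z i
  proof -
    have "dim_vec (affine_at f S (rpoint_of z)) = n"
      using f(1) by (simp add: affine_at_def is_param_affine_def)
    then have "dim_vec (\<theta> S z) = n" by (metis f(2)[OF S z] index_map_vec(2))
    then show carr: "\<theta> S z \<in> carrier_vec n" by (rule carrier_vecI)
    assume i: "i < n"
    have zc: "z \<in> carrier_vec d" using B(2) S z .
    have "real_of_int (\<theta> S z $ i) = affine_at f S (rpoint_of z) $ i"
      using f(2)[OF S z] carr i by (metis carrier_vecD index_map_vec(1))
    also have "\<dots> = (\<Sum>j<d. lin_part f $$ (i, j) * real_of_int (z $ j))
        + real S * size_part f $ i + const_part f $ i"
      using affine_at_index[OF f(1) _ i, of "rpoint_of z" S] zc by simp
    finally have eq: "real_of_int (\<theta> S z $ i) = \<dots>" .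
    have "\<bar>\<Sum>j<d. lin_part f $$ (i, j) * real_of_int (z $ j)\<bar>
        \<le> (\<Sum>j<d. \<bar>lin_part f $$ (i, j)\<bar> * B * real S)"
    proof (rule order_trans[OF sum_abs], rule sum_mono)
      fix j assume "j \<in> {..<d}"
      then have "\<bar>real_of_int (z $ j)\<bar> \<le> B * real S" using B(3)[OF S z] by simp
      then show "\<bar>lin_part f $$ (i, j) * real_of_int (z $ j)\<bar> \<le> \<bar>lin_part f $$ (i, j)\<bar> * B * real S"
        by (simp add: abs_mult mult.assoc mult_left_mono)
    qed
    moreover have "\<bar>real S * size_part f $ i\<bar> = \<bar>size_part f $ i\<bar> * real S"
      by (simp add: abs_mult)
    moreover have "\<bar>const_part f $ i\<bar> * 1 \<le> \<bar>const_part f $ i\<bar> * real S"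
      using S by (intro mult_left_mono) auto
    ultimately have "\<bar>real_of_int (\<theta> S z $ i)\<bar> \<le> c i * real S"
      unfolding eq c_def by (simp add: distrib_right sum_distrib_right)
    also have "\<dots> \<le> sum c {..<n} * real S"
      using c0 i by (intro mult_right_mono member_le_sum) auto
    finally show "\<bar>real_of_int (\<theta> S z $ i)\<bar> \<le> sum c {..<n} * real S" .
  qed
  show ?thesis
    using bound c0 by (intro exI[of _ "sum c {..<n}"]) (auto intro: sum_nonneg)
qed

text \<open>Merges the bounds of all nodes and rounds the constant up to a natural number, so that
  later counting stays within integer boxes.\<close>

lemma hsd_schedule_in_int_box:
  assumes prog: "tiled_program N d D" and sched: "hsd_schedule n N d D \<theta>"
  obtains C :: nat where "\<And>X S z. X \<in> N \<Longrightarrow> S > 0 \<Longrightarrow> z \<in> D X S \<Longrightarrow> \<theta> X S z \<in> int_box n (C * S)"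
proof -
  define P where "P X C \<longleftrightarrow> (\<forall>S>0. \<forall>z\<in>D X S.
    \<theta> X S z \<in> carrier_vec n \<and> (\<forall>i<n. \<bar>real_of_int (\<theta> X S z $ i)\<bar> \<le> C * real S))" for X C
  have "\<exists>C\<ge>0. \<forall>X\<in>N. P X C"
  proof (rule finite_common_bound)
    show "finite N" using prog by (simp add: tiled_program_def)
    show "\<exists>C\<ge>0. P X C" if "X \<in> N" for X
      unfolding P_def using prog sched that
      by (intro node_schedule_linear_bound[of "d X" "D X" n "\<theta> X"])
        (auto simp: tiled_program_def hsd_schedule_def)
    show "P X C'" if "P X C" "C \<le> C'" for X C C'
    proof -
      have "C * real S \<le> C' * real S" for S using that(2) by (simp add: mult_right_mono)
      with that(1) show ?thesis unfolding P_def by (meson order_trans)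
    qed
  qed
  then obtain C where C: "\<forall>X\<in>N. P X C" by auto
  show ?thesis
  proof (rule that[of "nat \<lceil>C\<rceil>"])
    fix X S z assume *: "X \<in> N" "S > 0" "z \<in> D X S"
    have "C * real S \<le> real (nat \<lceil>C\<rceil>) * real S"
      by (intro mult_right_mono) (auto simp: real_nat_ceiling_ge)
    moreover have "\<bar>real_of_int (\<theta> X S z $ i)\<bar> \<le> C * real S" if "i < n" for i
      using C * that unfolding P_def by blast
    ultimately have "\<bar>real_of_int (\<theta> X S z $ i)\<bar> \<le> real_of_int (int (nat \<lceil>C\<rceil> * S))"
      if "i < n" for i
      using that by (metis of_int_of_nat_eq of_nat_mult order_trans)
    then have "\<bar>\<theta> X S z $ i\<bar> \<le> int (nat \<lceil>C\<rceil> * S)" if "i < n" for i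
      using that by (metis of_int_abs of_int_le_iff)
    then show "\<theta> X S z \<in> int_box n (nat \<lceil>C\<rceil> * S)"
      using C * by (auto simp: int_box_def P_def)
  qed
qed

section \<open>Counting tiles per processor\<close>

lemma vec_first_in_int_box: "v \<in> int_box n b \<Longrightarrow> k \<le> n \<Longrightarrow> vec_first v k \<in> int_box k b"
  by (auto simp: int_box_def vec_first_def)

lemma vec_last_in_int_box: "v \<in> int_box n b \<Longrightarrow> m \<le> n \<Longrightarrow> vec_last v m \<in> int_box m b"
  by (auto simp: int_box_def vec_last_def)

text \<open>A space-time vector is recovered from its processor part and its time part, and the time
  part lies in a box of dimension \<open>n - k\<close>. Hence each processor vector is shared by at
  most as many elements of \<open>A\<close> as that box has points.\<close>

lemma card_le_card_vec_first:
  assumes A: "A \<subseteq> int_box n b" and k: "k \<le> n"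
  shows "card A \<le> card ((\<lambda>v. vec_first v k) ` A) * card (int_box (n - k) b)"
proof -
  have "finite A" using A finite_int_box finite_subset by blast
  have "inj_on (\<lambda>v. (vec_first v k, vec_last v (n - k))) A"
  proof (rule inj_onI)
    fix u v assume "u \<in> A" "v \<in> A"
      and eq: "(vec_first u k, vec_last u (n - k)) = (vec_first v k, vec_last v (n - k))"
    then have "u \<in> carrier_vec (k + (n - k))" "v \<in> carrier_vec (k + (n - k))"
      using A k by (auto simp: int_box_def)
    with eq show "u = v" by (metis Pair_inject vec_first_last_append)
  qed
  moreover have "(\<lambda>v. (vec_first v k, vec_last v (n - k))) ` A
      \<subseteq> (\<lambda>v. vec_first v k) ` A \<times> int_box (n - k) b"
    using A vec_last_in_int_box[of _ n b "n - k"] by auto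
  ultimately have "card A \<le> card ((\<lambda>v. vec_first v k) ` A \<times> int_box (n - k) b)"
    using \<open>finite A\<close> finite_int_box by (intro card_inj_on_le) auto
  then show ?thesis by (simp add: card_cartesian_product)
qed

lemma card_int_box_le_power:
  assumes "S > 0"
  shows "card (int_box k (C * S)) \<le> ((2 * C + 1) * S) ^ k"
proof -
  have "2 * (C * S) + 1 \<le> (2 * C + 1) * S" using assms by simp
  then show ?thesis
    using card_int_box_le[of k "C * S"] power_mono order_trans by blast
qed

section \<open>Two-sided bound on the memory overhead\<close>

theorem lemma8:
  fixes n k :: nat
    and N :: "'x set"
    and d :: "'x \<Rightarrow> nat"
    and D :: "'x \<Rightarrow> nat \<Rightarrow> ipoint set"
    and \<theta> :: "'x \<Rightarrow> nat \<Rightarrow> ipoint \<Rightarrow> ipoint"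
    and w :: "'x \<Rightarrow> nat \<Rightarrow> ipoint \<Rightarrow> real"
  assumes "n \<ge> 1" and "k \<le> n"
    and "tiled_program N d D"
    and "(\<lambda>S. real (num_tile_instances N D S)) \<in> \<Theta>(\<lambda>S. real S ^ n)"
    and "hsd_schedule n N d D \<theta>"
    and "constant_space_entries k N D \<theta> w"
  shows "(\<lambda>S. memory_overhead k N D \<theta> w S) \<in> \<Theta>(\<lambda>S. real S ^ k)"
proof -
  obtain C where C: "\<And>X S z. X \<in> N \<Longrightarrow> S > 0 \<Longrightarrow> z \<in> D X S \<Longrightarrow> \<theta> X S z \<in> int_box n (C * S)"
    using hsd_schedule_in_int_box[OF assms(3,5)] by blast
  \<comment> \<open>Chosen so that an interval of radius \<open>C * S\<close> contains at most
    \<open>c * S\<close> integers when \<open>S > 0\<close>.\<close>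
  define c where "c = 2 * C + 1"
  \<comment> \<open>Each node has its own array, so a processor used by several nodes is counted
    once for each.\<close>
  define V where "V S = (\<Sum>X\<in>N. card (virtual_procs k D \<theta> X S))" for S
  have vp: "virtual_procs k D \<theta> X S = (\<lambda>v. vec_first v k) ` \<theta> X S ` D X S" for X S
    by (simp add: virtual_procs_def proc_coords_def image_image)
  have vp_sub: "virtual_procs k D \<theta> X S \<subseteq> int_box k (C * S)" if "X \<in> N" "S > 0" for X S
    using C[OF that] vec_first_in_int_box[OF _ assms(2)] by (auto simp: vp)
  have V_upper: "V S \<le> card N * (c * S) ^ k" if "S > 0" for S
    unfolding V_def c_def
    using card_mono[OF finite_int_box vp_sub[OF _ that]] card_int_box_le_power[OF that, of k C]
    by (intro sum_bounded_above[where K = "((2 * C + 1) * S) ^ k", simplified of_nat_id])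
      (rule order_trans)
  have V_lower: "num_tile_instances N D S \<le> V S * (c * S) ^ (n - k)" if S: "S > 0" for S
  proof -
    have "card (D X S) \<le> card (virtual_procs k D \<theta> X S) * (c * S) ^ (n - k)" if X: "X \<in> N" for X
    proof -
      \<comment> \<open>Injectivity of the schedule enters here: counting tiles becomes counting
        space-time points.\<close>
      have "bij_betw (\<theta> X S) (D X S) (\<theta> X S ` D X S)"
        using assms(5) X S by (simp add: hsd_schedule_def is_node_schedule_def)
      then have "card (D X S) = card (\<theta> X S ` D X S)" by (rule bij_betw_same_card)
      also have "\<dots> \<le> card (virtual_procs k D \<theta> X S) * card (int_box (n - k) (C * S))"
        unfolding vp using C[OF X S] assms(2) by (intro card_le_card_vec_first) auto
      also have "\<dots> \<le> card (virtual_procs k D \<theta> X S) * (c * S) ^ (n - k)"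
        unfolding c_def by (intro mult_left_mono card_int_box_le_power S) simp
      finally show ?thesis .
    qed
    then show ?thesis
      unfolding num_tile_instances_def V_def sum_distrib_right by (rule sum_mono)
  qed
  obtain w1 w2 where w1: "w1 > 0" and w: "\<And>X S p. X \<in> N \<Longrightarrow> S > 0 \<Longrightarrow>
      p \<in> virtual_procs k D \<theta> X S \<Longrightarrow> w1 \<le> w X S p \<and> w X S p \<le> w2"
    using assms(6) unfolding constant_space_entries_def by metis
  have mem_lower: "w1 * real (V S) \<le> memory_overhead k N D \<theta> w S" if "S > 0" for S
  proof -
    have "w1 * real (V S) = (\<Sum>X\<in>N. \<Sum>p\<in>virtual_procs k D \<theta> X S. w1)"
      by (simp add: V_def sum_distrib_left mult.commute)
    also have "\<dots> \<le> memory_overhead k N D \<theta> w S"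
      unfolding memory_overhead_def using w that by (intro sum_mono) auto
    finally show ?thesis .
  qed
  have mem_upper: "memory_overhead k N D \<theta> w S \<le> w2 * real (V S)" if "S > 0" for S
  proof -
    have "memory_overhead k N D \<theta> w S \<le> (\<Sum>X\<in>N. \<Sum>p\<in>virtual_procs k D \<theta> X S. w2)"
      unfolding memory_overhead_def using w that by (intro sum_mono) auto
    also have "\<dots> = w2 * real (V S)"
      by (simp add: V_def sum_distrib_left mult.commute)
    finally show ?thesis .
  qed
  have mem_nonneg: "0 \<le> memory_overhead k N D \<theta> w S" if "S > 0" for S
    using mem_lower[OF that] w1 by (meson mult_nonneg_nonneg less_imp_le of_nat_0_le_iff order_trans)
  have "(\<lambda>S. memory_overhead k N D \<theta> w S) \<in> O(\<lambda>S. real S ^ k)"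
  proof (rule bigoI)
    \<comment> \<open>The absolute value is taken because \<open>w2\<close> has no known sign when
      there are no entries at all.\<close>
    show "\<forall>\<^sub>F S in at_top. norm (memory_overhead k N D \<theta> w S)
        \<le> (\<bar>w2\<bar> * (real (card N) * real c ^ k)) * norm (real S ^ k)"
      using eventually_gt_at_top[of 0]
    proof eventually_elim
      case (elim S)
      have "memory_overhead k N D \<theta> w S \<le> \<bar>w2\<bar> * real (V S)"
        by (rule order_trans[OF mem_upper[OF elim]]) (simp add: mult_right_mono)
      also have "real (V S) \<le> real (card N * (c * S) ^ k)"
        using V_upper[OF elim] of_nat_le_iff by blast
      also have "\<dots> = real (card N) * real c ^ k * real S ^ k"
        by (simp add: power_mult_distrib)
      finally show ?case using mem_nonneg[OF elim] by (simp add: mult_left_mono mult.assoc)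
    qed
  qed
  moreover have "(\<lambda>S. memory_overhead k N D \<theta> w S) \<in> \<Omega>(\<lambda>S. real S ^ k)"
  proof -
    obtain a where a: "a > 0" and
      ev: "\<forall>\<^sub>F S in at_top. a * norm (real S ^ n) \<le> norm (real (num_tile_instances N D S))"
      using assms(4) by (auto simp: bigtheta_def elim!: landau_omega.bigE)
    \<comment> \<open>About \<open>a * S ^ n\<close> tiles, at most \<open>(c * S) ^ (n - k)\<close>
      per processor of a node, force at least \<open>a * S ^ k / c ^ (n - k)\<close> entries, each
      of size at least \<open>w1\<close>.\<close>
    define b where "b = w1 * a / real c ^ (n - k)"
    have c0: "c > 0" by (simp add: c_def)
    show ?thesis
    proof (rule landau_omega.bigI)
      show "b > 0" using w1 a c0 by (simp add: b_def)
      show "\<forall>\<^sub>F S in at_top. b * norm (real S ^ k) \<le> norm (memory_overhead k N D \<theta> w S)"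
        using ev eventually_gt_at_top[of 0]
      proof eventually_elim
        case (elim S)
        have pos: "real c ^ (n - k) * real S ^ (n - k) > 0" using elim(2) c0 by simp
        have "a * real S ^ k * real S ^ (n - k) \<le> real (num_tile_instances N D S)"
          using elim(1) assms(2) by (simp add: mult.assoc flip: power_add)
        also have "\<dots> \<le> real (V S * (c * S) ^ (n - k))"
          using V_lower[OF elim(2)] of_nat_le_iff by blast
        also have "\<dots> = real (V S) * real c ^ (n - k) * real S ^ (n - k)"
          by (simp add: power_mult_distrib)
        finally have "a * real S ^ k \<le> real (V S) * real c ^ (n - k)"
          using elim(2) by simp
        then have "b * real S ^ k \<le> w1 * real (V S)"
          using w1 c0 by (simp add: b_def field_simps)
        then show ?case
          using mem_lower[OF elim(2)] mem_nonneg[OF elim(2)] by simp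
      qed
    qed
  qed
  ultimately show ?thesis by (rule bigthetaI)
qed

end
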